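(* Let $V$ be an $n$-dimensional complex vector space, let $0=d_0<d_1<\dots<d_p=n$ be integers, let $F_*=(0=F_0\subset F_1\subset\dots\subset F_{p-1}\subset F_p=V)$ be a partial flag of subspaces with $\dim F_k=d_k$ for all $k$, and let $\varphi$ be a nilpotent endomorphism of $V$. The following properties of the pair $(F_*,\varphi)$ are equivalent: 1. $\dim \varphi^{n-d_k}(F_k)=d_k$ for every $k\in\{0,\dots,p\}$; 2. there exists a basis $w_1,\dots,w_n$ of $V$ such that for all $k\in\{1,\dots,p\}$: ($\mathrm{a}_k$) $F_k=\langle w_1,\dots,w_{d_k}\rangle$, and for every $k\in\{2,\dots,p\}$: ($\mathrm{b}_k$) $$\varphi(w_x)=\begin{cases} w_{x+1}\ \mathrm{mod}\ \langle w_{d_1+2},\dots,w_n\rangle, & \text{if } x<d_1;\\ w_{d_{k-1}+1}\ \mathrm{mod}\ \langle w_{d_k+1},\dots,w_n\rangle, & \text{if } x=d_{k-1};\\ w_{x+1}\ \mathrm{mod}\ \langle w_{d_k+1},\dots,w_n\rangle, & \text{if } d_{k-1}<x<d_k;\\ 0, & \text{if } x=n.\end{cases}$$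
   Context: $\langle\cdots\rangle$ denotes linear span. "$u=v\ \mathrm{mod}\ S$" means $u-v\in S$. A span $\langle w_a,\dots,w_n\rangle$ with $a>n$ is the zero space. $\varphi^0=\mathrm{id}$. *)

theory Defs
  imports Complex_Main
begin

definition nilpotent_map :: "('v::zero \<Rightarrow> 'v) \<Rightarrow> bool" where
  "nilpotent_map f \<longleftrightarrow> (\<exists>m. \<forall>v. (f ^^ m) v = 0)"

text \<open>Partial flags of the whole space \<open>UNIV\<close>, of length \<open>p\<close> with dimension sequence
  \<open>d 0, \<dots>, d p\<close>. Only the values of \<open>d\<close> and \<open>F\<close> at indices at most \<open>p\<close> matter.\<close>

definition partial_flag ::
  "('k::field \<Rightarrow> 'v::ab_group_add \<Rightarrow> 'v) \<Rightarrow> nat \<Rightarrow> (nat \<Rightarrow> nat) \<Rightarrow> (nat \<Rightarrow> 'v set) \<Rightarrow> bool" where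
  "partial_flag scale p d F \<longleftrightarrow>
     F 0 = {0} \<and> F p = UNIV \<and>
     (\<forall>k<p. F k \<subset> F (k + 1)) \<and>
     (\<forall>k\<le>p. module.subspace scale (F k) \<and> vector_space.dim scale (F k) = d k)"

text \<open>The basis is indexed by \<open>1, \<dots>, n\<close>; other values of \<open>w\<close> are irrelevant.\<close>

definition ordered_basis ::
  "('k::field \<Rightarrow> 'v::ab_group_add \<Rightarrow> 'v) \<Rightarrow> nat \<Rightarrow> (nat \<Rightarrow> 'v) \<Rightarrow> bool" where
  "ordered_basis scale n w \<longleftrightarrow>
     inj_on w {1..n} \<and> \<not> module.dependent scale (w ` {1..n}) \<and>
     module.span scale (w ` {1..n}) = UNIV"

definition eq_mod :: "'v::ab_group_add \<Rightarrow> 'v \<Rightarrow> 'v set \<Rightarrow> bool" where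
  "eq_mod u v S \<longleftrightarrow> u - v \<in> S"

text \<open>The four cases are mutually exclusive as soon as \<open>d\<close> is strictly increasing on \<open>{0..p}\<close>
  with \<open>d p = n\<close> and \<open>2 \<le> k \<le> p\<close>. For a given \<open>k\<close> nothing is required of the indices \<open>x\<close> covered
  by none of them. An interval \<open>{a..n}\<close> with \<open>a > n\<close> is empty, so its span is zero.\<close>

definition cond_b ::
  "('k::field \<Rightarrow> 'v::ab_group_add \<Rightarrow> 'v) \<Rightarrow> nat \<Rightarrow> (nat \<Rightarrow> nat) \<Rightarrow> ('v \<Rightarrow> 'v) \<Rightarrow> (nat \<Rightarrow> 'v) \<Rightarrow> nat
    \<Rightarrow> bool" where
  "cond_b scale n d \<phi> w k \<longleftrightarrow>
     (\<forall>x\<in>{1..n}.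
        (x < d 1 \<longrightarrow>
          eq_mod (\<phi> (w x)) (w (x + 1)) (module.span scale (w ` {d 1 + 2..n}))) \<and>
        (x = d (k - 1) \<longrightarrow>
          eq_mod (\<phi> (w x)) (w (d (k - 1) + 1)) (module.span scale (w ` {d k + 1..n}))) \<and>
        (d (k - 1) < x \<and> x < d k \<longrightarrow>
          eq_mod (\<phi> (w x)) (w (x + 1)) (module.span scale (w ` {d k + 1..n}))) \<and>
        (x = n \<longrightarrow> \<phi> (w x) = 0))"

end

theory Submission
  imports Defs
begin

text \<open>Let \<open>W j\<close> be the image of \<open>\<phi>\<^sup>j\<close>. If \<open>p \<ge> 2\<close>, injectivity of \<open>\<phi>\<close> to the power \<open>n - d 1\<close> on
  \<open>F 1 \<noteq> 0\<close> forces \<open>\<phi>\<close> to be a single Jordan block, so that \<open>dim (W j) = n - j\<close>, the kernel of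
  the \<open>(n - j)\<close>-th power is \<open>W j\<close>, and condition 1 says that \<open>V = F k \<oplus> W (d k)\<close> for all \<open>k\<close>.
  Choose a cyclic vector \<open>u\<close> with \<open>\<phi>\<^sup>i u \<in> F 1 + W (d 1 + 1)\<close> for \<open>i < d 1\<close>, let
  \<open>w 1, \<dots>, w (d 1)\<close> be the components in \<open>F 1\<close> of these vectors, and for \<open>d (k - 1) \<le> x < d k\<close>,
  \<open>k \<ge> 2\<close>, let \<open>w (x + 1)\<close> be the projection of \<open>\<phi> (w x)\<close> to \<open>F k\<close> along \<open>W (d k)\<close>. Then
  \<open>w x\<close> equals \<open>\<phi>\<^sup>x\<^sup>-\<^sup>1 u\<close> modulo \<open>W x\<close>, hence \<open>W j\<close> is the span of \<open>w (j + 1), \<dots>, w n\<close>, which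
  yields condition 2. Conversely, under condition 2 the map \<open>\<phi>\<close> sends \<open>w x\<close> to \<open>w (x + 1)\<close> plus
  later basis vectors, so its \<open>(n - m)\<close>-th power maps the span of \<open>w 1, \<dots>, w m\<close> onto the span of
  the last \<open>m\<close> basis vectors.\<close>

section \<open>Spans and ordered bases\<close>

context vector_space
begin

text \<open>Downward induction on \<open>a\<close>: each step adds one generator to both spans, and
  the two new generators differ by an element of the span already shared.\<close>

lemma span_triangular:
  assumes "\<And>i. a \<le> i \<Longrightarrow> i \<le> n \<Longrightarrow> v i - b i \<in> span (b ` {i + 1..n})"
  shows "span (v ` {a..n}) = span (b ` {a..n::nat})"
proof (cases "a \<le> n")
  case True
  then show ?thesis
    using assms
  proof (induction a rule: inc_induct)
    case base
    then show ?case by simp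
  next
    case (step a)
    have IH: "span (v ` {Suc a..n}) = span (b ` {Suc a..n})"
      using step.IH step.prems by simp
    have d: "v a - b a \<in> span (b ` {Suc a..n})"
      using step.prems[of a] step.hyps by simp
    have "{a..n} = insert a {Suc a..n}"
      using step.hyps by auto
    then have im: "f ` {a..n} = insert (f a) (f ` {Suc a..n})" for f :: "nat \<Rightarrow> 'b"
      by simp
    have sub: "span (insert x X) \<subseteq> span (insert y Y)"
      if "span X = span Y" "x - y \<in> span Y" for x y X Y
    proof -
      have "x - y \<in> span (insert y Y)"
        using that(2) span_mono[OF subset_insertI, of Y y] by auto
      moreover have "y \<in> span (insert y Y)"
        by (simp add: span_base)
      ultimately have "x \<in> span (insert y Y)"
        using span_add by fastforce
      moreover have "X \<subseteq> span (insert y Y)"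
        using that(1) span_superset[of X] span_mono[OF subset_insertI, of Y y] by auto
      ultimately show ?thesis
        by (intro span_minimal) auto
    qed
    have d': "b a - v a \<in> span (v ` {Suc a..n})"
      using span_neg[OF d] IH by simp
    show ?case
      unfolding im using sub[OF IH d] sub[OF IH[symmetric] d'] by blast
  qed
qed simp

end

context finite_dimensional_vector_space
begin

lemma ordered_basis_if_spanning:
  assumes "dim UNIV = n" and "span (w ` {1..n}) = UNIV"
  shows "ordered_basis scale n w"
proof -
  have "n \<le> card (w ` {1..n})"
    using dim_le_card[of UNIV "w ` {1..n}"] assms by simp
  then have card: "card (w ` {1..n}) = n"
    using card_image_le[of "{1..n}" w] by simp
  moreover have "independent (w ` {1..n})"
    by (rule card_le_dim_spanning[of _ UNIV]) (use assms card in auto)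
  ultimately show ?thesis
    using assms(2) eq_card_imp_inj_on[of "{1..n}" w] by (simp add: ordered_basis_def)
qed

lemma dim_span_ordered_basis:
  assumes "ordered_basis scale n w" and "A \<subseteq> {1..n}"
  shows "dim (span (w ` A)) = card A"
proof -
  have "independent (w ` A)"
    using assms independent_mono[of "w ` {1..n}" "w ` A"] by (auto simp: ordered_basis_def)
  moreover have "inj_on w A"
    using assms inj_on_subset by (auto simp: ordered_basis_def)
  ultimately show ?thesis
    using dim_eq_card_independent card_image by (metis dim_span)
qed

lemma ordered_basis_exists:
  assumes "dim UNIV = n"
  shows "\<exists>w. ordered_basis scale n w"
proof -
  obtain B where B: "independent B" "span B = UNIV" "card B = n"
    using basis_exists[of UNIV] assms by (metis top.extremum_uniqueI)
  moreover have "finite B"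
    using B(1) finiteI_independent by blast
  ultimately obtain w where "bij_betw w {1..n} B"
    using ex_bij_betw_nat_finite_1 by blast
  then show ?thesis
    using B by (auto simp: ordered_basis_def bij_betw_def)
qed

end

section \<open>Images of the powers of a nilpotent map\<close>

locale nilpotent_endomorphism = finite_dimensional_vector_space scale Basis
  for scale :: "'a::field \<Rightarrow> 'b::ab_group_add \<Rightarrow> 'b" and Basis +
  fixes \<phi> :: "'b \<Rightarrow> 'b" and n :: nat
  assumes linear: "Vector_Spaces.linear scale scale \<phi>"
    and nilpotent: "nilpotent_map \<phi>"
    and dim_UNIV_n: "dim UNIV = n"
begin

abbreviation W :: "nat \<Rightarrow> 'b set" where
  "W j \<equiv> range (\<phi> ^^ j)"

text \<open>For nilpotent \<open>\<phi>\<close> this amounts to the vectors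
  \<open>(\<phi> ^^ i) u\<close> spanning the space. Taken modulo \<open>W 1\<close>, it carries
  over to every \<open>W j\<close> and survives changing \<open>u\<close> within
  \<open>W 1\<close>.\<close>

definition cyclic :: "'b \<Rightarrow> bool" where
  "cyclic u \<longleftrightarrow> (\<forall>v. \<exists>a. v - scale a u \<in> W 1)"

sublocale vector_space_pair scale scale ..

lemma linear_power: "Vector_Spaces.linear scale scale (\<phi> ^^ j)"
proof (induction j)
  case 0
  then show ?case by (simp add: linear_ident id_def)
next
  case (Suc j)
  then show ?case
    using Vector_Spaces.linear_compose[OF Suc linear] by (simp add: comp_def)
qed

lemmas power_simps = linear_add[OF linear_power] linear_diff[OF linear_power]
  linear_scale[OF linear_power] linear_0[OF linear_power]

lemma subspace_W: "subspace (W j)"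
  using linear_subspace_image[OF linear_power] by simp

lemma span_W: "span (W j) = W j"
  using span_eq_iff subspace_W by blast

lemma power_in_W: "(\<phi> ^^ i) v \<in> W (i + j)" if "v \<in> W j"
  using that by (auto simp: funpow_add)

lemma W_antimono: "W j \<subseteq> W i" if "i \<le> j"
proof -
  have "\<phi> ^^ j = \<phi> ^^ i \<circ> \<phi> ^^ (j - i)"
    using that by (simp flip: funpow_add)
  then show ?thesis
    by auto
qed

lemma power_in_W_le: "(\<phi> ^^ i) v \<in> W j" if "j \<le> i"
  using W_antimono[OF that] by blast

lemma W_Suc_eq: "W (i + j) = W j" if "W (Suc j) = W j"
proof (induction i)
  case (Suc i)
  have "W (Suc i + j) = \<phi> ` W (i + j)"
    by (auto simp: image_image)
  also have "\<dots> = W (Suc j)"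
    unfolding Suc.IH by (auto simp: image_image)
  finally show ?case
    using that by simp
qed simp

text \<open>If the dimension does not drop, the images are constant from \<open>j\<close> on, and
  nilpotency makes that constant image zero; truncated subtraction covers this case.\<close>

lemma dim_W_Suc: "dim (W (Suc j)) \<le> dim (W j) - 1"
proof (cases "dim (W j) \<le> dim (W (Suc j))")
  case True
  then have "W (Suc j) = W j"
    by (intro subspace_dim_equal subspace_W W_antimono) simp_all
  moreover obtain m where "\<And>v. (\<phi> ^^ m) v = 0"
    using nilpotent by (auto simp: nilpotent_map_def)
  then have "W m = {0}"
    by auto
  ultimately have "W j \<subseteq> {0}"
    using W_Suc_eq[of j m] W_antimono[of m "m + j"] by auto
  then show ?thesis
    using W_antimono[of j "Suc j"] dim_eq_0 by (metis le_SucI order_refl order_trans zero_le)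
qed simp

lemma dim_W_add: "dim (W (i + j)) \<le> dim (W j) - i"
proof (induction i)
  case (Suc i)
  then show ?case
    using dim_W_Suc[of "i + j"] by simp
qed simp

lemma dim_W_le: "dim (W j) \<le> n - j"
  using dim_W_add[of j 0] dim_UNIV_n by simp

lemma W_n: "W n = {0}"
proof -
  have "W n \<subseteq> {0}"
    using dim_W_le[of n] by simp
  then show ?thesis
    using subspace_0[OF subspace_W, of n] by blast
qed

section \<open>Cyclic vectors and the filtration by images\<close>

lemma cyclic_exists:
  assumes "0 < m" and "m < n" and "dim (W (n - m)) \<ge> m"
  shows "\<exists>e. cyclic e"
proof -
  \<comment> \<open>Every step lowers a nonzero dimension by at least one, so dimension
    \<open>m\<close> after \<open>n - m\<close> steps allows the first step to lose only one. Thus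
    \<open>W 1\<close> is a hyperplane, and any vector outside it is cyclic.\<close>
  have "n - m = (n - m - 1) + 1"
    using assms by simp
  then have "m \<le> dim (W 1) - (n - m - 1)"
    using assms(3) dim_W_add[of "n - m - 1" 1] by (metis order_trans)
  then have dim1: "dim (W 1) = n - 1"
    using assms dim_W_le[of 1] by linarith
  then have "W 1 \<noteq> UNIV"
    using assms dim_UNIV_n by auto
  then obtain e where e: "e \<notin> W 1"
    by blast
  have "dim (insert e (W 1)) = n"
    unfolding dim_insert span_W using e dim1 assms by simp
  then have "span (insert e (W 1)) = UNIV"
    using dim_UNIV_n by (intro subspace_dim_equal) auto
  then have "v \<in> span (insert e (W 1))" for v
    by simp
  then show ?thesis
    unfolding cyclic_def span_breakdown_eq span_W by blast
qed

lemma cyclic_W: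
  assumes "cyclic u" and "v \<in> W j"
  shows "\<exists>a. v - scale a ((\<phi> ^^ j) u) \<in> W (Suc j)"
proof -
  obtain x where x: "v = (\<phi> ^^ j) x"
    using assms(2) by blast
  obtain a where "x - scale a u \<in> W 1"
    using assms(1) unfolding cyclic_def by blast
  from power_in_W[OF this, of j] show ?thesis
    unfolding x by (auto simp: power_simps)
qed

text \<open>Downward induction from \<open>W n = {0}\<close>: by \<open>cyclic_W\<close>, adding the
  single vector \<open>(\<phi> ^^ j) u\<close> to \<open>W (Suc j)\<close> generates
  \<open>W j\<close>.\<close>

lemma W_eq_span:
  assumes "cyclic u" and "j \<le> n"
  shows "W j = span ((\<lambda>i. (\<phi> ^^ (i - 1)) u) ` {j + 1..n})"
  using assms(2)
proof (induction j rule: inc_induct)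
  case base
  then show ?case using W_n by simp
next
  case (step j)
  let ?b = "\<lambda>i. (\<phi> ^^ (i - 1)) u"
  have "{j + 1..n} = insert (j + 1) {Suc j + 1..n}"
    using step.hyps by auto
  then have im: "?b ` {j + 1..n} = insert ((\<phi> ^^ j) u) (?b ` {Suc j + 1..n})"
    by simp
  show ?case
  proof
    show "W j \<subseteq> span (?b ` {j + 1..n})"
      unfolding im using cyclic_W[OF assms(1), of _ j] step.IH span_breakdown_eq by blast
    have "(\<phi> ^^ (i - 1)) u \<in> W j" if "i \<in> {j + 1..n}" for i
      by (rule power_in_W_le) (use that in auto)
    then show "span (?b ` {j + 1..n}) \<subseteq> W j"
      by (intro span_minimal subspace_W) auto
  qed
qed

text \<open>Since \<open>W x\<close> is spanned by the powers from \<open>(\<phi> ^^ x) u\<close>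
  on, \<open>w\<close> is unitriangular over the powers of \<open>u\<close>.\<close>

lemma span_eq_W:
  assumes "cyclic u" and "\<And>x. 1 \<le> x \<Longrightarrow> x \<le> n \<Longrightarrow> w x - (\<phi> ^^ (x - 1)) u \<in> W x" and "j \<le> n"
  shows "span (w ` {j + 1..n}) = W j"
proof -
  have "span (w ` {j + 1..n}) = span ((\<lambda>i. (\<phi> ^^ (i - 1)) u) ` {j + 1..n})"
    using assms(2) W_eq_span[OF assms(1)] by (intro span_triangular) auto
  then show ?thesis
    using W_eq_span assms by simp
qed

lemma dim_W:
  assumes "cyclic u" and "j \<le> n"
  shows "dim (W j) = n - j"
proof -
  let ?b = "\<lambda>i. (\<phi> ^^ (i - 1)) u"
  have "span (?b ` {1..n}) = UNIV"
    using W_eq_span[OF assms(1), of 0] by simp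
  then have "ordered_basis scale n ?b"
    using ordered_basis_if_spanning dim_UNIV_n by blast
  then have "dim (span (?b ` {j + 1..n})) = n - j"
    by (subst dim_span_ordered_basis) auto
  then show ?thesis
    using W_eq_span assms by simp
qed

text \<open>Climb from \<open>W j\<close> to \<open>W (Suc j)\<close> for \<open>j < m\<close>: a
  nonzero coefficient of \<open>(\<phi> ^^ j) u\<close> in \<open>z\<close> would, after applying
  \<open>\<phi> ^^ (n - m)\<close>, put \<open>(\<phi> ^^ (n - m + j)) u\<close> into the next
  image. Two consecutive images would coincide, against \<open>dim_W\<close>.\<close>

lemma kernel_subset_W:
  assumes "cyclic u" and "m \<le> n" and "(\<phi> ^^ (n - m)) z = 0"
  shows "z \<in> W m"
proof -
  have "z \<in> W j" if "j \<le> m" for j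
    using that
  proof (induction j)
    case (Suc j)
    let ?i = "n - m + j"
    obtain a where a: "z - scale a ((\<phi> ^^ j) u) \<in> W (Suc j)"
      using cyclic_W[OF assms(1), of z j] Suc by auto
    have "a = 0"
    proof (rule ccontr)
      assume "a \<noteq> 0"
      have "- scale a ((\<phi> ^^ ?i) u) \<in> W (Suc ?i)"
        using power_in_W[OF a, of "n - m"] assms(3) by (simp add: power_simps funpow_add)
      then have "scale (inverse a) (scale a ((\<phi> ^^ ?i) u)) \<in> W (Suc ?i)"
        using subspace_scale subspace_neg subspace_W minus_minus by metis
      then have u: "(\<phi> ^^ ?i) u \<in> W (Suc ?i)"
        using \<open>a \<noteq> 0\<close> by simp
      have "W ?i \<subseteq> W (Suc ?i)"
      proof
        fix v
        assume "v \<in> W ?i"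
        then obtain c where "v - scale c ((\<phi> ^^ ?i) u) \<in> W (Suc ?i)"
          using cyclic_W[OF assms(1)] by blast
        from subspace_add[OF subspace_W this subspace_scale[OF subspace_W u, of c]]
        show "v \<in> W (Suc ?i)"
          by simp
      qed
      then have "dim (W ?i) \<le> dim (W (Suc ?i))"
        by (rule dim_subset)
      then show False
        using dim_W[OF assms(1), of ?i] dim_W[OF assms(1), of "Suc ?i"] Suc.prems assms(2)
        by linarith
    qed
    then show ?case
      using a by simp
  qed simp
  then show ?thesis
    by simp
qed

text \<open>The image of \<open>S\<close> has the dimension of \<open>W (n - m)\<close> and so fills
  it. Hence \<open>v\<close> agrees with some \<open>f\<close> in \<open>S\<close> up to the kernel
  of \<open>\<phi> ^^ (n - m)\<close>, which lies in \<open>W m\<close>.\<close>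

lemma complement_W:
  assumes "cyclic u" and "subspace S" and "m \<le> n" and "dim ((\<phi> ^^ (n - m)) ` S) = m"
  shows "\<exists>f\<in>S. v - f \<in> W m"
proof -
  have "(\<phi> ^^ (n - m)) ` S = W (n - m)"
    using dim_W[OF assms(1), of "n - m"] assms
    by (intro subspace_dim_equal linear_subspace_image[OF linear_power] subspace_W) auto
  then obtain f where "f \<in> S" "(\<phi> ^^ (n - m)) v = (\<phi> ^^ (n - m)) f"
    by (metis imageE rangeI)
  then show ?thesis
    using kernel_subset_W[OF assms(1,3), of "v - f"] by (auto simp: power_simps)
qed

text \<open>The powers \<open>\<phi>\<^sup>i u\<close> are moved into \<open>S + W (m + 1)\<close> one at a time, from \<open>i = m - 1\<close> down to
  \<open>i = 0\<close>: replacing \<open>u\<close> by \<open>u - a \<phi>\<^sup>m\<^sup>-\<^sup>i u\<close> corrects \<open>\<phi>\<^sup>i u\<close> by a multiple of \<open>\<phi>\<^sup>m u\<close> and changes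
  the later powers only within \<open>W (m + 1)\<close>.\<close>

lemma cyclic_adjust:
  assumes "cyclic e" and "\<And>v. \<exists>f\<in>S. v - f \<in> W m"
  shows "\<exists>u. cyclic u \<and> (\<forall>i<m. \<exists>f\<in>S. (\<phi> ^^ i) u - f \<in> W (m + 1))"
proof -
  have "\<exists>u. cyclic u \<and> (\<forall>i. m - j \<le> i \<and> i < m \<longrightarrow> (\<exists>f\<in>S. (\<phi> ^^ i) u - f \<in> W (m + 1)))"
    if "j \<le> m" for j
    using that
  proof (induction j)
    case 0
    then show ?case using assms(1) by auto
  next
    case (Suc j)
    then obtain u where u: "cyclic u"
      and uS: "\<And>i. m - j \<le> i \<Longrightarrow> i < m \<Longrightarrow> \<exists>f\<in>S. (\<phi> ^^ i) u - f \<in> W (m + 1)"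
      by auto
    let ?i = "m - Suc j"
    obtain f where f: "f \<in> S" "(\<phi> ^^ ?i) u - f \<in> W m"
      using assms(2) by blast
    obtain a where a: "(\<phi> ^^ ?i) u - f - scale a ((\<phi> ^^ m) u) \<in> W (m + 1)"
      using cyclic_W[OF u f(2)] by auto
    let ?u = "u - scale a ((\<phi> ^^ Suc j) u)"
    have pow: "(\<phi> ^^ i) ?u = (\<phi> ^^ i) u - scale a ((\<phi> ^^ (i + Suc j)) u)" for i
      unfolding power_simps funpow_add comp_apply ..
    have "cyclic ?u"
      unfolding cyclic_def
    proof
      fix v
      obtain c where "v - scale c u \<in> W 1"
        using u unfolding cyclic_def by blast
      moreover have "scale c (scale a ((\<phi> ^^ Suc j) u)) \<in> W 1"
        by (intro subspace_scale subspace_W power_in_W_le) simp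
      ultimately have "v - scale c u + scale c (scale a ((\<phi> ^^ Suc j) u)) \<in> W 1"
        by (rule subspace_add[OF subspace_W])
      then have "v - scale c ?u \<in> W 1"
        by (simp add: scale_right_diff_distrib algebra_simps)
      then show "\<exists>c. v - scale c ?u \<in> W 1" ..
    qed
    moreover have "\<exists>f\<in>S. (\<phi> ^^ i) ?u - f \<in> W (m + 1)" if i: "m - Suc j \<le> i" "i < m" for i
    proof (cases "i = ?i")
      case True
      have "?i + Suc j = m"
        using Suc.prems by simp
      then have "(\<phi> ^^ i) ?u - f \<in> W (m + 1)"
        unfolding pow True using a by (simp add: algebra_simps)
      then show ?thesis
        using f by blast
    next
      case False
      then have "m - j \<le> i"
        using i by simp
      then obtain f where f: "f \<in> S" "(\<phi> ^^ i) u - f \<in> W (m + 1)"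
        using uS i by blast
      have "scale a ((\<phi> ^^ (i + Suc j)) u) \<in> W (m + 1)"
        by (intro subspace_scale subspace_W power_in_W_le) (use False i in simp)
      from subspace_diff[OF subspace_W f(2) this] have "(\<phi> ^^ i) ?u - f \<in> W (m + 1)"
        unfolding pow by (simp add: algebra_simps)
      then show ?thesis
        using f by blast
    qed
    ultimately show ?case
      by blast
  qed
  from this[of m] show ?thesis
    by simp
qed

section \<open>Powers of a map that is triangular on a basis\<close>

lemma power_ordered_basis:
  assumes "\<And>x. 1 \<le> x \<Longrightarrow> x < n \<Longrightarrow> \<phi> (w x) - w (x + 1) \<in> span (w ` {x + 2..n})"
    and "\<phi> (w n) = 0" and "1 \<le> x" and "x + j \<le> n"
  shows "(\<phi> ^^ j) (w x) - w (x + j) \<in> span (w ` {x + j + 1..n})"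
  using assms(4)
proof (induction j)
  case 0
  then show ?case by (simp add: span_zero)
next
  case (Suc j)
  let ?S = "span (w ` {x + j + 2..n})"
  \<comment> \<open>The map sends the span of a final segment of the basis into that of the next
    one, so the error of the induction hypothesis moves one index further.\<close>
  have "\<phi> (w y) \<in> ?S" if "y \<in> {x + j + 1..n}" for y
  proof (cases "y = n")
    case True
    then show ?thesis
      using assms(2) by (simp add: span_zero)
  next
    case False
    then have "\<phi> (w y) - w (y + 1) \<in> span (w ` {y + 2..n})"
      using assms(1)[of y] that assms(3) by simp
    moreover have "span (w ` {y + 2..n}) \<subseteq> ?S"
      by (intro span_mono image_mono) (use that in auto)
    moreover have "w (y + 1) \<in> ?S"
      by (intro span_base imageI) (use that False in auto)
    ultimately show ?thesis
      using span_add by fastforce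
  qed
  then have "\<phi> ` span (w ` {x + j + 1..n}) \<subseteq> ?S"
    unfolding linear_span_image[OF linear, symmetric] by (intro span_minimal) auto
  then have "\<phi> ((\<phi> ^^ j) (w x) - w (x + j)) \<in> ?S"
    using Suc by auto
  moreover have "\<phi> (w (x + j)) - w (x + j + 1) \<in> ?S"
    using assms(1)[of "x + j"] assms(3) Suc.prems by simp
  ultimately have "\<phi> ((\<phi> ^^ j) (w x) - w (x + j)) + (\<phi> (w (x + j)) - w (x + j + 1)) \<in> ?S"
    by (rule span_add)
  then show ?case
    by (simp add: linear_diff[OF linear])
qed

lemma dim_power_image_if_triangular:
  assumes "ordered_basis scale n w"
    and "\<And>x. 1 \<le> x \<Longrightarrow> x < n \<Longrightarrow> \<phi> (w x) - w (x + 1) \<in> span (w ` {x + 2..n})"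
    and "\<phi> (w n) = 0" and "m \<le> n"
  shows "dim ((\<phi> ^^ (n - m)) ` span (w ` {1..m})) = m"
proof -
  \<comment> \<open>Shifting the index by \<open>n - m\<close> aligns the images of the first
    \<open>m\<close> basis vectors with the last \<open>m\<close> basis vectors.\<close>
  define v where "v i = (\<phi> ^^ (n - m)) (w (i - (n - m)))" for i
  have "{n - m + 1..n} = (\<lambda>i. i + (n - m)) ` {1..m}"
    unfolding image_add_atLeastAtMost' using assms(4) by simp
  then have im: "v ` {n - m + 1..n} = (\<phi> ^^ (n - m)) ` w ` {1..m}"
    by (simp only: image_image v_def add_diff_cancel_right')
  have "span (v ` {n - m + 1..n}) = span (w ` {n - m + 1..n})"
  proof (rule span_triangular)
    fix i
    assume "n - m + 1 \<le> i" "i \<le> n"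
    then show "v i - w i \<in> span (w ` {i + 1..n})"
      using power_ordered_basis[OF assms(2,3), of "i - (n - m)" "n - m"] by (simp add: v_def)
  qed
  then show ?thesis
    unfolding linear_span_image[OF linear_power, symmetric] im[symmetric]
    using dim_span_ordered_basis[OF assms(1), of "{n - m + 1..n}"] assms(4) by simp
qed

end

section \<open>Flags and their index blocks\<close>

locale nilpotent_flag = nilpotent_endomorphism scale Basis \<phi> n
  for scale :: "'a::field \<Rightarrow> 'b::ab_group_add \<Rightarrow> 'b" and Basis and \<phi> and n +
  fixes p :: nat and d :: "nat \<Rightarrow> nat" and F :: "nat \<Rightarrow> 'b set"
  assumes d_0: "d 0 = 0" and d_Suc: "\<And>k. k < p \<Longrightarrow> d k < d (Suc k)" and d_p: "d p = n"
    and flag: "partial_flag scale p d F"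
begin

lemma F_subspace: "k \<le> p \<Longrightarrow> subspace (F k)"
  and dim_F: "k \<le> p \<Longrightarrow> dim (F k) = d k"
  and F_0: "F 0 = {0}" and F_p: "F p = UNIV"
  using flag by (auto simp: partial_flag_def)

lemma F_mono: "F i \<subseteq> F j" if "i \<le> j" "j \<le> p"
  using that
proof (induction j rule: dec_induct)
  case (step j)
  then have "F j \<subseteq> F (Suc j)"
    using flag unfolding partial_flag_def by (simp add: psubset_imp_subset)
  then show ?case
    using step by simp
qed simp

lemma d_less: "d i < d j" if "i < j" "j \<le> p"
  using that
proof (induction j)
  case (Suc j)
  then show ?case
    using d_Suc[of j] by (cases "i = j") auto
qed simp

lemma d_mono: "d i \<le> d j" if "i \<le> j" "j \<le> p"
  using d_less[of i j] that by (cases "i = j") auto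

lemma d_le_n: "d k \<le> n" if "k \<le> p"
  using d_mono[of k p] d_p that by simp

lemma step_index:
  assumes "x < n" and "d 1 \<le> x"
  obtains k where "k \<in> {2..p}" "d (k - 1) \<le> x" "x < d k"
proof -
  define k where "k = (LEAST k. x < d k)"
  have "x < d k"
    unfolding k_def by (rule LeastI[of _ p]) (use assms d_p in simp)
  moreover have "k \<le> p"
    unfolding k_def by (rule Least_le) (use assms d_p in simp)
  moreover have "k \<noteq> 0" "k \<noteq> 1"
    using assms \<open>x < d k\<close> d_0 by (metis not_less0, metis not_le)
  moreover have "\<not> x < d (k - 1)"
    using not_less_Least[of "k - 1" "\<lambda>k. x < d k"] \<open>k \<noteq> 0\<close> unfolding k_def[symmetric] by simp
  ultimately show ?thesis
    using that[of k] by auto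
qed

section \<open>From an adapted basis to the dimension condition\<close>

lemma dim_power_image_if_cond_b:
  assumes w: "ordered_basis scale n w" and p: "2 \<le> p"
    and b: "\<And>k. k \<in> {2..p} \<Longrightarrow> cond_b scale n d \<phi> w k" and "m \<le> n"
  shows "dim ((\<phi> ^^ (n - m)) ` span (w ` {1..m})) = m"
proof (rule dim_power_image_if_triangular[OF w])
  have n: "n \<ge> 1"
    using d_less[of 0 p] d_p p by simp
  show "\<phi> (w n) = 0"
    using bspec[OF b[of 2, unfolded cond_b_def], of n] p n by simp
  fix x
  assume x: "1 \<le> x" "x < n"
  \<comment> \<open>The clauses differ in where the error span starts, \<open>d 1 + 2\<close> or
    \<open>d k + 1\<close>; in either case this is at least \<open>x + 2\<close>.\<close>
  show "\<phi> (w x) - w (x + 1) \<in> span (w ` {x + 2..n})"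
  proof (cases "x < d 1")
    case True
    then have "\<phi> (w x) - w (x + 1) \<in> span (w ` {d 1 + 2..n})"
      using bspec[OF b[of 2, unfolded cond_b_def eq_mod_def], of x] p x by simp
    moreover have "span (w ` {d 1 + 2..n}) \<subseteq> span (w ` {x + 2..n})"
      by (intro span_mono image_mono) (use True in auto)
    ultimately show ?thesis
      by blast
  next
    case False
    then obtain k where k: "k \<in> {2..p}" "d (k - 1) \<le> x" "x < d k"
      using step_index[of x] x by auto
    have "\<phi> (w x) - w (x + 1) \<in> span (w ` {d k + 1..n})"
      using bspec[OF b[OF k(1), unfolded cond_b_def eq_mod_def], of x] x k(2,3)
      by (cases "x = d (k - 1)") auto
    moreover have "span (w ` {d k + 1..n}) \<subseteq> span (w ` {x + 2..n})"
      by (intro span_mono image_mono) (use k in auto)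
    ultimately show ?thesis
      by blast
  qed
qed (fact \<open>m \<le> n\<close>)

section \<open>Construction of an adapted basis\<close>

lemma adapted_basis_exists:
  assumes p: "2 \<le> p"
    and dims: "\<And>k. k \<le> p \<Longrightarrow> dim ((\<phi> ^^ (n - d k)) ` F k) = d k"
  shows "\<exists>w. ordered_basis scale n w \<and> (\<forall>k\<in>{1..p}. F k = span (w ` {1..d k})) \<and>
    (\<forall>k\<in>{2..p}. cond_b scale n d \<phi> w k)"
proof -
  have d1: "0 < d 1" "d 1 < n"
    using d_less[of 0 1] d_less[of 1 p] d_p p by auto
  have "(\<phi> ^^ (n - d 1)) ` F 1 \<subseteq> W (n - d 1)"
    by auto
  from dim_subset[OF this] obtain e where e: "cyclic e"
    using cyclic_exists[of "d 1"] d1 dims[of 1] p by auto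
  have proj: "\<exists>f\<in>F k. v - f \<in> W (d k)" if "k \<le> p" for k v
    using complement_W[OF e F_subspace[OF that] d_le_n[OF that] dims[OF that]] .
  \<comment> \<open>Projecting powers of \<open>e\<close> to \<open>F 1\<close> would leave errors
    in \<open>W (d 1)\<close> only. The clause for \<open>x < d 1\<close> has a span starting at
    \<open>d 1 + 2\<close>, which will be \<open>W (d 1 + 1)\<close>; hence the passage to
    \<open>u\<close>.\<close>
  obtain u where u: "cyclic u" and uF: "\<And>i. i < d 1 \<Longrightarrow> \<exists>f\<in>F 1. (\<phi> ^^ i) u - f \<in> W (d 1 + 1)"
    using cyclic_adjust[OF e, of "F 1" "d 1"] proj[of 1] p by auto
  obtain g where g: "\<And>i. i < d 1 \<Longrightarrow> g i \<in> F 1 \<and> (\<phi> ^^ i) u - g i \<in> W (d 1 + 1)"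
    using uF by metis
  \<comment> \<open>For \<open>1 \<le> x \<le> n\<close>, \<open>\<kappa> x\<close> is the block of
    \<open>x\<close>: \<open>F (\<kappa> x)\<close> is the first flag member of dimension at least
    \<open>x\<close>, the one that must contain \<open>w x\<close>.\<close>
  define \<kappa> where "\<kappa> x = (LEAST k. x \<le> d k)" for x
  have \<kappa>: "x \<le> d (\<kappa> x) \<and> \<kappa> x \<le> p" if "x \<le> n" for x
    unfolding \<kappa>_def
    using that d_p LeastI[of "\<lambda>k. x \<le> d k" p] Least_le[of "\<lambda>k. x \<le> d k" p] by simp
  have \<kappa>_eq: "\<kappa> x = k" if "d (k - 1) < x" "x \<le> d k" "k \<le> p" for x k
    unfolding \<kappa>_def
  proof (rule Least_equality)
    fix j
    assume "x \<le> d j"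
    show "k \<le> j"
    proof (rule ccontr)
      assume "\<not> k \<le> j"
      then have "d j \<le> d (k - 1)"
        using that by (intro d_mono) auto
      then show False
        using that \<open>x \<le> d j\<close> by simp
    qed
  qed fact
  obtain P where P: "\<And>k v. k \<le> p \<Longrightarrow> P k v \<in> F k \<and> v - P k v \<in> W (d k)"
    using proj by metis
  \<comment> \<open>The value 0 at index 0 is a dummy: as \<open>0 < d 1\<close>, the recursion
    takes \<open>w 1\<close> from \<open>g 0\<close> without using it.\<close>
  define w where
    "w = rec_nat 0 (\<lambda>x y. if x < d 1 then g x else P (\<kappa> (Suc x)) (\<phi> y))"
  have w_low: "w (Suc x) = g x" if "x < d 1" for x
    using that by (simp add: w_def)
  have w_high: "w (Suc x) = P (\<kappa> (Suc x)) (\<phi> (w x))" if "d 1 \<le> x" for x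
    using that by (simp add: w_def)
  have w_F: "w x \<in> F k" if x: "1 \<le> x" "x \<le> d k" "k \<le> p" for x k
  proof -
    obtain y where y: "x = Suc y"
      using x by (cases x) auto
    have "\<kappa> x \<le> k"
      unfolding \<kappa>_def using x by (intro Least_le)
    have "x \<le> n"
      using x d_le_n[of k] by simp
    show ?thesis
    proof (cases "y < d 1")
      case True
      have "k \<ge> 1"
        using x d_0 by (cases k) auto
      then show ?thesis
        using g[OF True] w_low[OF True] F_mono[of 1 k] x y by auto
    next
      case False
      then have "w x \<in> F (\<kappa> x)"
        using w_high[of y] P[of "\<kappa> x" "\<phi> (w y)"] \<kappa>[OF \<open>x \<le> n\<close>] y by simp
      then show ?thesis
        using F_mono[OF \<open>\<kappa> x \<le> k\<close>] x by blast
    qed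
  qed
  have low: "w x - (\<phi> ^^ (x - 1)) u \<in> W (d 1 + 1)" if "1 \<le> x" "x \<le> d 1" for x
  proof -
    have "w x = g (x - 1)" "x - 1 < d 1"
      using w_low[of "x - 1"] that by simp_all
    then have "- ((\<phi> ^^ (x - 1)) u - w x) \<in> W (d 1 + 1)"
      using g by (intro subspace_neg[OF subspace_W]) metis
    then show ?thesis
      unfolding minus_diff_eq .
  qed
  have high: "\<phi> (w x) - w (x + 1) \<in> W (d (\<kappa> (x + 1)))" if "d 1 \<le> x" "x < n" for x
    using w_high[of x] P[of "\<kappa> (x + 1)"] \<kappa>[of "x + 1"] that by simp
  \<comment> \<open>Beyond \<open>d 1\<close>, applying \<open>\<phi>\<close> moves the old error
    into \<open>W (Suc x)\<close>, and the projection adds an error in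
    \<open>W (d (\<kappa> (Suc x)))\<close>, which is contained there because
    \<open>Suc x \<le> d (\<kappa> (Suc x))\<close>.\<close>
  have w_u: "w x - (\<phi> ^^ (x - 1)) u \<in> W x" if "1 \<le> x" "x \<le> n" for x
    using that
  proof (induction x)
    case (Suc x)
    show ?case
    proof (cases "x < d 1")
      case True
      then show ?thesis
        using low[of "Suc x"] W_antimono[of "Suc x" "d 1 + 1"] by auto
    next
      case False
      then have x: "1 \<le> x" "x < n"
        using d1 Suc.prems by auto
      then have "\<phi> (w x - (\<phi> ^^ (x - 1)) u) \<in> W (Suc x)"
        using power_in_W[of _ x 1] Suc.IH by simp
      then have "\<phi> (w x) - (\<phi> ^^ x) u \<in> W (Suc x)"
        using x by (cases x) (auto simp: linear_diff[OF linear])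
      moreover have "\<phi> (w x) - w (Suc x) \<in> W (Suc x)"
        using high[of x] W_antimono[of "Suc x" "d (\<kappa> (x + 1))"] \<kappa>[of "x + 1"] False x by auto
      ultimately have "\<phi> (w x) - (\<phi> ^^ x) u - (\<phi> (w x) - w (Suc x)) \<in> W (Suc x)"
        by (rule subspace_diff[OF subspace_W])
      then show ?thesis
        by simp
    qed
  qed simp
  have span_w: "span (w ` {j + 1..n}) = W j" if "j \<le> n" for j
    using span_eq_W[OF u w_u that] by simp
  have basis: "ordered_basis scale n w"
    using ordered_basis_if_spanning[OF dim_UNIV_n] span_w[of 0] by simp
  moreover have "F k = span (w ` {1..d k})" if "k \<in> {1..p}" for k
  proof (rule subspace_dim_equal[symmetric])
    show "span (w ` {1..d k}) \<subseteq> F k"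
      using w_F F_subspace that by (intro span_minimal) auto
    show "dim (F k) \<le> dim (span (w ` {1..d k}))"
      using dim_span_ordered_basis[OF basis, of "{1..d k}"] d_le_n[of k] dim_F that by simp
  qed (use F_subspace that in auto)
  moreover have "cond_b scale n d \<phi> w k" if k: "k \<in> {2..p}" for k
  proof -
    have step: "\<phi> (w x) - w (x + 1) \<in> span (w ` {d k + 1..n})"
      if "d (k - 1) \<le> x" "x < d k" for x
    proof -
      have "d 1 \<le> d (k - 1)" and "d k \<le> n"
        using k by (auto intro!: d_mono d_le_n)
      moreover have "\<kappa> (x + 1) = k"
        using k that by (intro \<kappa>_eq) auto
      ultimately show ?thesis
        using high[of x] span_w[of "d k"] that by simp
    qed
    \<comment> \<open>Both vectors agree with \<open>(\<phi> ^^ x) u\<close> modulo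
      \<open>W (d 1 + 1)\<close>; \<open>low\<close> applies to \<open>x + 1\<close> because
      \<open>x + 1 \<le> d 1\<close>.\<close>
    have "\<phi> (w x) - w (x + 1) \<in> span (w ` {d 1 + 2..n})" if x: "1 \<le> x" "x < d 1" for x
    proof -
      have "\<phi> (w x - (\<phi> ^^ (x - 1)) u) \<in> W (Suc (d 1 + 1))"
        using power_in_W[of _ "d 1 + 1" 1] low x by simp
      then have "\<phi> (w x) - (\<phi> ^^ x) u \<in> W (Suc (d 1 + 1))"
        using x by (cases x) (auto simp: linear_diff[OF linear])
      then have "\<phi> (w x) - (\<phi> ^^ x) u \<in> W (d 1 + 1)"
        using W_antimono[of "d 1 + 1" "Suc (d 1 + 1)"] by auto
      from subspace_diff[OF subspace_W this low[of "x + 1"]] show ?thesis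
        using x span_w[of "d 1 + 1"] d1 by simp
    qed
    moreover have "\<phi> (w n) = 0"
    proof -
      have "w n \<in> W (n - 1)"
        using span_w[of "n - 1"] d1 by (auto intro: span_base)
      then have "\<phi> (w n) \<in> W n"
        using power_in_W[of "w n" "n - 1" 1] d1 by simp
      then show ?thesis
        using W_n by simp
    qed
    moreover have "d (k - 1) < d k"
      using d_less k by simp
    ultimately show ?thesis
      unfolding cond_b_def eq_mod_def using step by simp
  qed
  ultimately show ?thesis
    by blast
qed

section \<open>The equivalence, with short flags included\<close>

lemma dim_power_image_F_0: "dim ((\<phi> ^^ (n - d 0)) ` F 0) = d 0"
  using F_0 d_0 by (simp add: power_simps)

lemma dim_power_image_F_p: "dim ((\<phi> ^^ (n - d p)) ` F p) = d p"
  using F_p d_p dim_UNIV_n by simp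

lemma dim_power_image_iff_adapted_basis:
  "(\<forall>k\<in>{0..p}. dim ((\<phi> ^^ (n - d k)) ` F k) = d k) \<longleftrightarrow>
    (\<exists>w. ordered_basis scale n w \<and> (\<forall>k\<in>{1..p}. F k = span (w ` {1..d k})) \<and>
      (\<forall>k\<in>{2..p}. cond_b scale n d \<phi> w k))"
    (is "?L \<longleftrightarrow> ?R")
proof (cases "2 \<le> p")
  case True
  show ?thesis
  proof
    assume ?L
    then show ?R
      using adapted_basis_exists[OF True] by auto
  next
    assume ?R
    then obtain w where w: "ordered_basis scale n w" "\<forall>k\<in>{1..p}. F k = span (w ` {1..d k})"
      "\<forall>k\<in>{2..p}. cond_b scale n d \<phi> w k"
      by blast
    show ?L
    proof
      fix k
      assume "k \<in> {0..p}"
      then consider "k = 0" | "k \<in> {1..p}"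
        by fastforce
      then show "dim ((\<phi> ^^ (n - d k)) ` F k) = d k"
      proof cases
        case 2
        then show ?thesis
          using dim_power_image_if_cond_b[OF w(1) True] w d_le_n[of k] by simp
      qed (use dim_power_image_F_0 in simp)
    qed
  qed
next
  \<comment> \<open>For \<open>p \<le> 1\<close> the flag contains only the zero space and the whole
    space. Both sides then hold: the dimensions are immediate, and any ordered basis is
    adapted.\<close>
  case False
  then have k: "k = 0 \<or> k = p" if "k \<in> {0..p}" for k
    using that by auto
  obtain w where w: "ordered_basis scale n w"
    using ordered_basis_exists[OF dim_UNIV_n] by blast
  have "F k = span (w ` {1..d k})" if "k \<in> {1..p}" for k
    using k[of k] that w F_p d_p by (auto simp: ordered_basis_def)
  then have ?R
    using w False by auto
  moreover have ?L
    using k dim_power_image_F_0 dim_power_image_F_p by blast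
  ultimately show ?thesis
    by blast
qed

end

theorem lemma6p1:
  fixes scale :: "complex \<Rightarrow> 'v::ab_group_add \<Rightarrow> 'v"
    and B :: "'v set"
    and n p :: nat
    and d :: "nat \<Rightarrow> nat"
    and F :: "nat \<Rightarrow> 'v set"
    and \<phi> :: "'v \<Rightarrow> 'v"
  assumes "finite_dimensional_vector_space scale B"
    and "vector_space.dim scale (UNIV :: 'v set) = n"
    and "d 0 = 0" and "\<forall>k<p. d k < d (k + 1)" and "d p = n"
    and "partial_flag scale p d F"
    and "Vector_Spaces.linear scale scale \<phi>"
    and "nilpotent_map \<phi>"
  shows "(\<forall>k\<in>{0..p}. vector_space.dim scale ((\<phi> ^^ (n - d k)) ` F k) = d k) \<longleftrightarrow>
    (\<exists>w :: nat \<Rightarrow> 'v.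
       ordered_basis scale n w \<and>
       (\<forall>k\<in>{1..p}. F k = module.span scale (w ` {1..d k})) \<and>
       (\<forall>k\<in>{2..p}. cond_b scale n d \<phi> w k))"
proof -
  interpret finite_dimensional_vector_space scale B
    by fact
  interpret nilpotent_flag scale B \<phi> n p d F
    by (intro nilpotent_flag.intro nilpotent_endomorphism.intro nilpotent_endomorphism_axioms.intro
        nilpotent_flag_axioms.intro) (use assms in auto)
  show ?thesis
    by (rule dim_power_image_iff_adapted_basis)
qed

end
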